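(* Let $a\in(0,1)$ be fixed. Then, as $n\to\infty$ through even integers, $$P_n^T\bigl(2;2\lfloor an/2\rfloor\bigr)=\log\left(1-\frac{2}{\sqrt{2\pi na}}+\frac{2\bigl(1-a-\sqrt{1-a}\bigr)}{\pi n\sqrt{a}\,(1-a)}+O\bigl(n^{-3/2}\bigr)\right).$$
   Context: A positive path of length $n$ is a lattice path in $\mathbb{Z}^2$ starting at the origin, consisting of $n$ steps each equal to $(1,1)$ or $(1,-1)$, and never going below the line $Y=0$. A Dyck path is a positive path ending on $Y=0$. A visit is a vertex of the path on $Y=0$ other than the origin. For $z>0$, $T_n(z)=\sum z^{\#\text{visits}}$ over all positive paths of length $n$, and for even $n$, $D_n(z)=\sum z^{\#\text{visits}}$ over all Dyck paths of length $n$ (with $T_0(z)=D_0(z)=1$). For even $q$ with $0<q<n$, the pressure of adsorbing directed paths at the vertex $(q,0)$ is $P_n^T(z;q)=\log T_n(z;q)-\log T_n(z)$, where $T_n(z;q)$ is the same sum as $T_n(z)$ restricted to paths not passing through $(q,0)$; equivalently $$P_n^T(z;q)=\log\left(1-\frac{D_q(z)\,T_{n-q}(z)}{T_n(z)}\right).$$ *)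

theory Defs
  imports Complex_Main "HOL-Library.Landau_Symbols"
begin

text \<open>A path of length \<open>n\<close> is given by the list of its \<open>n + 1\<close> vertices in \<open>\<int>\<^sup>2\<close>.\<close>

definition positive_paths :: "nat \<Rightarrow> (int \<times> int) list set" where
  "positive_paths n = {p. length p = Suc n \<and> p ! 0 = (0, 0) \<and>
     (\<forall>i<n. p ! Suc i = (fst (p ! i) + 1, snd (p ! i) + 1) \<or>
            p ! Suc i = (fst (p ! i) + 1, snd (p ! i) - 1)) \<and>
     (\<forall>v\<in>set p. 0 \<le> snd v)}"

text \<open>The vertices of a path are pairwise distinct (the first coordinate increases at each step),
  so counting visits as a set loses no multiplicity.\<close>

definition visits :: "(int \<times> int) list \<Rightarrow> nat" where
  "visits p = card {v \<in> set p. snd v = 0 \<and> v \<noteq> (0, 0)}"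

definition partition_T :: "nat \<Rightarrow> real \<Rightarrow> real" where
  "partition_T n z = (\<Sum>p\<in>positive_paths n. z ^ visits p)"

definition partition_T_avoid :: "nat \<Rightarrow> real \<Rightarrow> nat \<Rightarrow> real" where
  "partition_T_avoid n z q = (\<Sum>p\<in>{p \<in> positive_paths n. (int q, 0) \<notin> set p}. z ^ visits p)"

text \<open>Only meaningful for \<open>z > 0\<close> and even \<open>q\<close> with \<open>0 < q < n\<close>; in particular, for \<open>q = 0\<close> the
  first logarithm is the junk value \<open>ln 0\<close>.\<close>

definition pressure :: "nat \<Rightarrow> real \<Rightarrow> nat \<Rightarrow> real" where
  "pressure n z q = ln (partition_T_avoid n z q) - ln (partition_T n z)"

definition even_at_top :: "nat filter" where
  "even_at_top = inf at_top (principal {n. even n})"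

text \<open>Finiteness ensures that the sums above are not zero by convention.\<close>

lemma finite_positive_paths: "finite (positive_paths n)"
proof (rule finite_subset)
  let ?S = "{- int n..int n} \<times> {- int n..int n}"
  show "positive_paths n \<subseteq> {p. set p \<subseteq> ?S \<and> length p = Suc n}"
  proof
    fix p assume p: "p \<in> positive_paths n"
    have len: "length p = Suc n" and p0: "p ! 0 = (0, 0)"
      and st: "\<And>i. i < n \<Longrightarrow> p ! Suc i = (fst (p ! i) + 1, snd (p ! i) + 1) \<or>
            p ! Suc i = (fst (p ! i) + 1, snd (p ! i) - 1)"
      using p by (auto simp: positive_paths_def)
    have bd: "i \<le> n \<Longrightarrow> \<bar>fst (p ! i)\<bar> \<le> int i \<and> \<bar>snd (p ! i)\<bar> \<le> int i" for i
    proof (induction i)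
      case 0
      then show ?case using p0 by simp
    next
      case (Suc i)
      then show ?case using st[of i] by auto
    qed
    have "p ! i \<in> ?S" if "i \<le> n" for i
      using bd[OF that] that by (auto simp: mem_Times_iff)
    then have "set p \<subseteq> ?S" using len
      by (metis in_set_conv_nth less_Suc_eq_le subsetI)
    then show "p \<in> {p. set p \<subseteq> ?S \<and> length p = Suc n}" using len by blast
  qed
  show "finite {p. set p \<subseteq> ?S \<and> length p = Suc n}"
    by (rule finite_lists_length_eq) simp
qed

end

theory Submission
  imports Defs "HOL-Analysis.Gamma_Function" "HOL-Real_Asymp.Real_Asymp"
begin

text \<open>
  At \<open>z = 2\<close> the weight of the positive paths of length \<open>n\<close> ending at height \<open>h\<close> is the number of
  unconstrained walks ending there (each excursion may be reflected). Hence
  \<open>D\<^sub>2\<^sub>k = 4\<^sup>k u\<^sub>k\<close> and \<open>T\<^sub>2\<^sub>m = 4\<^sup>m (1 + u\<^sub>m) / 2\<close> with \<open>u\<^sub>k = binomial(2k, k) / 4\<^sup>k\<close>, and the pressure is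
  the logarithm of \<open>1 - u\<^sub>k (1 + u\<^bsub>m-k\<^esub>) / (1 + u\<^sub>m)\<close>, where \<open>n = 2m\<close> and \<open>q = 2k\<close>.
  Wallis' product and monotonicity give \<open>1 / sqrt (pi (k + 1/2)) \<le> u\<^sub>k \<le> 1 / sqrt (pi k)\<close>. This
  bracket has width \<open>O(k\<^bsup>-3/2\<^esup>)\<close>, so it also absorbs the rounding of \<open>a m\<close> to the integer \<open>k\<close>;
  the quotient expands to \<open>u\<^sub>k (1 + u\<^bsub>m-k\<^esub> - u\<^sub>m)\<close> up to third-order terms.
\<close>

subsection \<open>Weighted path counts at \<open>z = 2\<close>\<close>

definition ending_at :: "((int \<times> int) list \<Rightarrow> bool) \<Rightarrow> nat \<Rightarrow> int \<Rightarrow> (int \<times> int) list set" where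
  "ending_at Q n h = {p \<in> positive_paths n. p ! n = (int n, h) \<and> Q p}"

definition height_weight :: "((int \<times> int) list \<Rightarrow> bool) \<Rightarrow> nat \<Rightarrow> int \<Rightarrow> real" where
  "height_weight Q n h = (\<Sum>p\<in>ending_at Q n h. 2 ^ visits p)"

section \<open>Vertices of a positive path; appending and removing the last one\<close>

lemma positive_path_nth:
  assumes "p \<in> positive_paths n" "i \<le> n"
  shows "fst (p ! i) = int i" "0 \<le> snd (p ! i)" "snd (p ! i) \<le> int i"
proof -
  have st: "\<And>i. i < n \<Longrightarrow> p ! Suc i = (fst (p ! i) + 1, snd (p ! i) + 1) \<or>
            p ! Suc i = (fst (p ! i) + 1, snd (p ! i) - 1)"
    and p0: "p ! 0 = (0, 0)"
    using assms(1) by (auto simp: positive_paths_def)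
  have "fst (p ! i) = int i \<and> snd (p ! i) \<le> int i"
    using assms(2)
  proof (induction i)
    case 0
    then show ?case using p0 by simp
  next
    case (Suc i)
    then show ?case using st[of i] by auto
  qed
  then show "fst (p ! i) = int i" "snd (p ! i) \<le> int i" by auto
  show "0 \<le> snd (p ! i)"
    using assms by (auto simp: positive_paths_def)
qed

lemma positive_path_fst_le:
  assumes "p \<in> positive_paths n" "v \<in> set p"
  shows "fst v \<le> int n"
proof -
  have "length p = Suc n" using assms by (auto simp: positive_paths_def)
  then obtain i where "i \<le> n" "v = p ! i"
    using assms(2) by (metis in_set_conv_nth less_Suc_eq_le)
  then show ?thesis using positive_path_nth[OF assms(1)] by auto
qed

text \<open>The first coordinate of a vertex is its index, so abscissa \<open>q\<close> can occur
  only at position \<open>q\<close>.\<close>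

lemma positive_path_mem_iff:
  assumes "p \<in> positive_paths n" "q \<le> n"
  shows "(int q, y) \<in> set p \<longleftrightarrow> p ! q = (int q, y)"
proof
  have len: "length p = Suc n" using assms by (auto simp: positive_paths_def)
  show "p ! q = (int q, y)" if mem: "(int q, y) \<in> set p"
  proof -
    obtain i where "i \<le> n" "p ! i = (int q, y)"
      using mem len by (auto simp: in_set_conv_nth less_Suc_eq_le)
    moreover from this have "i = q"
      using positive_path_nth(1)[OF assms(1), of i] by simp
    ultimately show ?thesis by simp
  qed
  show "(int q, y) \<in> set p" if "p ! q = (int q, y)"
    using nth_mem[of q p] that len assms(2) by simp
qed

lemma positive_paths_snoc:
  assumes "p \<in> positive_paths n" "p ! n = (int n, h)" "h' = h + 1 \<or> h' = h - 1" "0 \<le> h'"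
  shows "p @ [(int (Suc n), h')] \<in> positive_paths (Suc n)"
proof -
  let ?r = "p @ [(int (Suc n), h')]"
  have p: "length p = Suc n" "p ! 0 = (0, 0)" "\<forall>v\<in>set p. 0 \<le> snd v"
    "\<And>i. i < n \<Longrightarrow> p ! Suc i = (fst (p ! i) + 1, snd (p ! i) + 1) \<or>
            p ! Suc i = (fst (p ! i) + 1, snd (p ! i) - 1)"
    using assms(1) by (auto simp: positive_paths_def)
  have "?r ! Suc i = (fst (?r ! i) + 1, snd (?r ! i) + 1) \<or>
      ?r ! Suc i = (fst (?r ! i) + 1, snd (?r ! i) - 1)" if "i < Suc n" for i
  proof (cases "i = n")
    case True
    then show ?thesis using p(1) assms(2,3) by (auto simp: nth_append)
  next
    case False
    then show ?thesis using p(1) p(4)[of i] that by (simp add: nth_append)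
  qed
  then show ?thesis
    using p assms(4) by (simp add: positive_paths_def nth_append)
qed

lemma positive_paths_butlast:
  assumes "p \<in> positive_paths (Suc n)" "p ! Suc n = (int (Suc n), h)"
  shows "butlast p \<in> positive_paths n" "p = butlast p @ [(int (Suc n), h)]"
    "butlast p ! n = (int n, h - 1) \<or> butlast p ! n = (int n, h + 1)"
proof -
  have len: "length p = Suc (Suc n)" using assms by (auto simp: positive_paths_def)
  have nth: "butlast p ! i = p ! i" if "i \<le> n" for i
    using that len by (simp add: nth_butlast)
  show "butlast p \<in> positive_paths n"
    using assms(1) len nth by (auto simp: positive_paths_def dest: in_set_butlastD)
  have "p \<noteq> []" using len by auto
  then show "p = butlast p @ [(int (Suc n), h)]"
    using len assms(2) by (metis append_butlast_last_id diff_Suc_1 last_conv_nth)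
  have "p ! Suc n = (fst (p ! n) + 1, snd (p ! n) + 1) \<or> p ! Suc n = (fst (p ! n) + 1, snd (p ! n) - 1)"
    using assms(1) by (auto simp: positive_paths_def)
  then show "butlast p ! n = (int n, h - 1) \<or> butlast p ! n = (int n, h + 1)"
    using assms(2) nth[of n] by (cases "p ! n") auto
qed

lemma visits_snoc:
  assumes "p \<in> positive_paths n"
  shows "visits (p @ [(int (Suc n), h)]) = (if h = 0 then Suc (visits p) else visits p)"
proof -
  let ?V = "{v \<in> set p. snd v = 0 \<and> v \<noteq> (0, 0)}"
  \<comment> \<open>The new vertex lies strictly to the right of all earlier ones, so the
    cardinality in \<open>visits\<close> really grows when \<open>h = 0\<close>.\<close>
  have new: "(int (Suc n), h) \<notin> set p"
    using positive_path_fst_le[OF assms] by force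
  have "{v \<in> set (p @ [(int (Suc n), h)]). snd v = 0 \<and> v \<noteq> (0, 0)}
      = (if h = 0 then insert (int (Suc n), h) ?V else ?V)"
    by auto
  moreover have "finite ?V" "(int (Suc n), h) \<notin> ?V" using new by auto
  ultimately show ?thesis
    by (cases "h = 0") (simp_all add: visits_def del: of_nat_Suc)
qed

section \<open>Recursion in the length for the weight at a given final height\<close>

lemma finite_ending_at: "finite (ending_at Q n h)"
  using finite_positive_paths[of n] by (simp add: ending_at_def)

lemma height_weight_neg: "h < 0 \<Longrightarrow> height_weight Q n h = 0"
proof -
  assume "h < 0"
  then have "ending_at Q n h = {}"
    using positive_path_nth(2)[of _ n n] by (force simp: ending_at_def)
  then show ?thesis by (simp add: height_weight_def)
qed

text \<open>Deleting the last vertex is a bijection onto the disjoint union of the paths ending one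
  lower and one higher. If \<open>h = 0\<close>, the deleted vertex was a visit, which accounts for
  the factor 2. The assumption on \<open>Q\<close> makes the predicate invariant under this
  deletion.\<close>

lemma height_weight_Suc:
  assumes Q: "\<And>p h. p \<in> positive_paths n \<Longrightarrow> Q (p @ [(int (Suc n), h)]) = Q p" and "0 \<le> h"
  shows "height_weight Q (Suc n) h =
    (if h = 0 then 2 else 1) * (height_weight Q n (h - 1) + height_weight Q n (h + 1))"
proof -
  let ?f = "\<lambda>p. p @ [(int (Suc n), h)]"
  let ?A = "ending_at Q n (h - 1)" and ?B = "ending_at Q n (h + 1)"
  have eq: "ending_at Q (Suc n) h = ?f ` (?A \<union> ?B)"
  proof (intro equalityI subsetI)
    fix p assume p: "p \<in> ending_at Q (Suc n) h"
    then have pp: "p \<in> positive_paths (Suc n)" "p ! Suc n = (int (Suc n), h)" "Q p"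
      by (auto simp: ending_at_def)
    note b = positive_paths_butlast[OF pp(1,2)]
    have "Q (butlast p)" using Q[OF b(1), of h] b(2) pp(3) by simp
    then have "butlast p \<in> ?A \<union> ?B"
      using b(1,3) by (auto simp: ending_at_def)
    then show "p \<in> ?f ` (?A \<union> ?B)" using b(2) by blast
  next
    fix p assume "p \<in> ?f ` (?A \<union> ?B)"
    then obtain r where r: "p = ?f r" "r \<in> ?A \<union> ?B" by blast
    then have rp: "r \<in> positive_paths n" "Q r" by (auto simp: ending_at_def)
    have "p \<in> positive_paths (Suc n)"
      using r \<open>0 \<le> h\<close> by (auto simp del: of_nat_Suc simp: ending_at_def intro: positive_paths_snoc)
    moreover have "length r = Suc n" using rp by (simp add: positive_paths_def)
    ultimately show "p \<in> ending_at Q (Suc n) h"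
      using r(1) rp Q[OF rp(1)] by (simp add: ending_at_def nth_append)
  qed
  have "height_weight Q (Suc n) h = (\<Sum>p\<in>?A \<union> ?B. 2 ^ visits (?f p))"
    unfolding height_weight_def eq by (subst sum.reindex) (auto simp: inj_on_def)
  also have "\<dots> = (\<Sum>p\<in>?A \<union> ?B. (if h = 0 then 2 else 1) * 2 ^ visits p)"
    by (intro sum.cong refl) (auto simp del: of_nat_Suc simp: visits_snoc ending_at_def)
  also have "\<dots> = (if h = 0 then 2 else 1) * (\<Sum>p\<in>?A \<union> ?B. 2 ^ visits p)"
    by (simp add: sum_distrib_left)
  also have "(\<Sum>p\<in>?A \<union> ?B. (2::real) ^ visits p) = height_weight Q n (h - 1) + height_weight Q n (h + 1)"
    unfolding height_weight_def
    by (intro sum.union_disjoint finite_ending_at) (auto simp: ending_at_def)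
  finally show ?thesis .
qed

text \<open>With weight 2 per visit the recursion at height 0 is the one obtained by reflecting
  unconstrained walks, so it is solved by plain binomial coefficients.\<close>

definition binomial_at_height :: "nat \<Rightarrow> int \<Rightarrow> real" where
  "binomial_at_height n h =
    (if 0 \<le> h \<and> even (int n + h) then real (n choose nat ((int n + h) div 2)) else 0)"

text \<open>For positive \<open>h\<close> this is Pascal's rule. At \<open>h = 0\<close> the lower
  neighbour contributes nothing, and the factor 2 replaces it by the symmetry of the row. For the
  wrong parity all terms vanish.\<close>

lemma binomial_at_height_Suc:
  assumes "0 \<le> h"
  shows "binomial_at_height (Suc n) h =
    (if h = 0 then 2 else 1) * (binomial_at_height n (h - 1) + binomial_at_height n (h + 1))"
proof (cases "even (int (Suc n) + h)")
  case False
  then show ?thesis by (auto simp: binomial_at_height_def)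
next
  case True
  then obtain j where j: "int (Suc n) + h = 2 * j" by (elim evenE)
  \<comment> \<open>\<open>j\<close> is the number of up-steps of a walk of length
    \<open>Suc n\<close> ending at \<open>h\<close>; \<open>k\<close> is that number with one
    up-step removed.\<close>
  define k where "k = nat (j - 1)"
  have "j > 0" using j assms by linarith
  then have k: "j = int (Suc k)" by (simp add: k_def)
  show ?thesis
  proof (cases "h = 0")
    case True
    with j k have n: "n = 2 * k + 1" by simp
    have "real (Suc n choose Suc k) = 2 * real (n choose Suc k)"
    proof -
      have "n choose k = n choose Suc k"
        using n binomial_symmetric[of k n] by (simp add: Suc_diff_le)
      then show ?thesis by simp
    qed
    then show ?thesis using True n
      by (simp add: binomial_at_height_def nat_add_distrib)
  next
    case False
    have "(int n + (h - 1)) div 2 = int k" "(int n + (h + 1)) div 2 = int (Suc k)"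
      "(int (Suc n) + h) div 2 = int (Suc k)" using j k by auto
    moreover have "even (int n + (h - 1))" "even (int n + (h + 1))" using j by presburger+
    ultimately show ?thesis using False assms True
      by (simp add: binomial_at_height_def del: of_nat_Suc)
  qed
qed

text \<open>The recursion is linear and determines all later weights, so starting at time
  \<open>q\<close> with mass \<open>c\<close> concentrated at height 0 gives \<open>c\<close> times
  the solution started at the origin. Invariance of \<open>Q\<close> is required only from time
  \<open>q\<close> on.\<close>

lemma height_weight_shift:
  assumes Q: "\<And>n p h. q \<le> n \<Longrightarrow> p \<in> positive_paths n \<Longrightarrow> Q (p @ [(int (Suc n), h)]) = Q p"
    and init: "\<And>h. height_weight Q q h = c * binomial_at_height 0 h"
  shows "height_weight Q (q + m) h = c * binomial_at_height m h"
proof (induction m arbitrary: h)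
  case 0
  then show ?case using init by simp
next
  case (Suc m)
  show ?case
  proof (cases "0 \<le> h")
    case True
    then have "height_weight Q (Suc (q + m)) h =
        (if h = 0 then 2 else 1) * (height_weight Q (q + m) (h - 1) + height_weight Q (q + m) (h + 1))"
      by (intro height_weight_Suc Q) auto
    then show ?thesis
      using Suc binomial_at_height_Suc[OF True, of m] by (simp add: algebra_simps)
  next
    case False
    then show ?thesis by (simp add: height_weight_neg binomial_at_height_def)
  qed
qed

lemma binomial_at_height_0: "binomial_at_height 0 h = (if h = 0 then 1 else 0)"
proof (cases "h > 0 \<and> even h")
  case True
  then have "nat (h div 2) > 0" by auto
  then show ?thesis using True by (auto simp: binomial_at_height_def)
qed (auto simp: binomial_at_height_def)

lemma ending_at_0: "ending_at (\<lambda>_. True) 0 h = (if h = 0 then {[(0, 0)]} else {})"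
proof -
  have "p \<in> ending_at (\<lambda>_. True) 0 h \<longleftrightarrow> p = [(0, 0)] \<and> h = 0" for p
  proof (cases p)
    case (Cons v vs)
    then show ?thesis by (cases v; cases vs) (auto simp: ending_at_def positive_paths_def)
  qed (simp add: ending_at_def positive_paths_def)
  then show ?thesis by (cases "h = 0") auto
qed

lemma height_weight_True: "height_weight (\<lambda>_. True) n h = binomial_at_height n h"
proof -
  have "visits [(0, 0)] = 0" by (simp add: visits_def)
  then have "height_weight (\<lambda>_. True) 0 h = 1 * binomial_at_height 0 h" for h
    by (simp add: height_weight_def ending_at_0 binomial_at_height_0)
  then show ?thesis
    using height_weight_shift[where Q = "\<lambda>_. True" and q = 0 and c = 1 and m = n and h = h] by simp
qed

text \<open>This is the factorisation of paths at \<open>(q, 0)\<close>, obtained without cutting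
  them: at time \<open>q\<close> the predicate keeps only the mass at height 0, and vertices
  appended later have abscissa greater than \<open>q\<close>, so they cannot change it.\<close>

lemma height_weight_through:
  "height_weight (\<lambda>p. (int q, 0) \<in> set p) (q + m) h = binomial_at_height q 0 * binomial_at_height m h"
proof (rule height_weight_shift)
  fix h
  show "height_weight (\<lambda>p. (int q, 0) \<in> set p) q h = binomial_at_height q 0 * binomial_at_height 0 h"
  proof -
    have "ending_at (\<lambda>p. (int q, 0) \<in> set p) q h = (if h = 0 then ending_at (\<lambda>_. True) q 0 else {})"
      by (auto simp: ending_at_def positive_path_mem_iff)
    then show ?thesis
      using height_weight_True[of q 0] by (simp add: height_weight_def binomial_at_height_0)
  qed
qed auto

section \<open>Partition functions as sums over the final height\<close>

lemma sum_paths_by_height: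
  "(\<Sum>p\<in>{p \<in> positive_paths n. Q p}. 2 ^ visits p) = (\<Sum>h\<in>{0..int n}. height_weight Q n h)"
proof -
  have "\<exists>h\<in>{0..int n}. p ! n = (int n, h)" if "p \<in> positive_paths n" for p
    using positive_path_nth[OF that order_refl] by (cases "p ! n") auto
  then have eq: "{p \<in> positive_paths n. Q p} = (\<Union>h\<in>{0..int n}. ending_at Q n h)"
    by (auto simp: ending_at_def)
  show ?thesis
    unfolding eq height_weight_def
    by (intro sum.UNION_disjoint) (auto simp: finite_ending_at, auto simp: ending_at_def)
qed

lemma partition_T_sum: "partition_T n 2 = (\<Sum>h\<in>{0..int n}. binomial_at_height n h)"
  using sum_paths_by_height[of n "\<lambda>_. True"] by (simp add: partition_T_def height_weight_True)

lemma binomial_at_height_eq_0: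
  assumes "int n < h"
  shows "binomial_at_height n h = 0"
proof (cases "even (int n + h)")
  case True
  then obtain j where "int n + h = 2 * j" by (elim evenE)
  with assms show ?thesis by (simp add: binomial_at_height_def)
qed (simp add: binomial_at_height_def)

lemma partition_T_avoid_eq:
  assumes "q \<le> n"
  shows "partition_T_avoid n 2 q = partition_T n 2 - binomial_at_height q 0 * partition_T (n - q) 2"
proof -
  let ?Q = "\<lambda>p. (int q, 0) \<in> set p"
  have "(\<Sum>p\<in>{p \<in> positive_paths n. ?Q p}. (2::real) ^ visits p)
      = (\<Sum>h\<in>{0..int n}. binomial_at_height q 0 * binomial_at_height (n - q) h)"
    using assms height_weight_through[of q "n - q"] by (subst sum_paths_by_height) simp
  also have "\<dots> = binomial_at_height q 0 * partition_T (n - q) 2"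
    unfolding partition_T_sum sum_distrib_left
    \<comment> \<open>After the visit to \<open>(q, 0)\<close> only \<open>n - q\<close> steps
      remain, so the heights above \<open>n - q\<close> contribute zero.\<close>
    by (rule sum.mono_neutral_right) (auto simp: binomial_at_height_eq_0)
  finally have th: "(\<Sum>p\<in>{p \<in> positive_paths n. ?Q p}. (2::real) ^ visits p)
    = binomial_at_height q 0 * partition_T (n - q) 2" .
  have "partition_T n 2 = (\<Sum>p\<in>{p \<in> positive_paths n. ?Q p} \<union> {p \<in> positive_paths n. \<not> ?Q p}. 2 ^ visits p)"
    unfolding partition_T_def by (rule sum.cong) auto
  also have "\<dots> = binomial_at_height q 0 * partition_T (n - q) 2 + partition_T_avoid n 2 q"
    unfolding th[symmetric] partition_T_avoid_def
    by (rule sum.union_disjoint) (auto simp: finite_positive_paths)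
  finally show ?thesis by simp
qed

text \<open>By symmetry the upper and lower halves of row \<open>2 * m\<close> have equal sums;
  together they cover the row with the central entry counted twice.\<close>

lemma sum_upper_half_binomial:
  "2 * (\<Sum>j\<le>m. (2 * m) choose (m + j)) = 2 ^ (2 * m) + ((2 * m) choose m)"
proof -
  let ?b = "\<lambda>k. (2 * m) choose k"
  have "(\<Sum>j\<le>m. ?b (m + j)) = (\<Sum>k\<in>{m..2 * m}. ?b k)"
    by (rule sum.reindex_bij_witness[of _ "\<lambda>k. k - m" "\<lambda>j. m + j"]) auto
  moreover have "(\<Sum>j\<le>m. ?b (m + j)) = (\<Sum>k\<le>m. ?b k)"
    by (rule sum.reindex_bij_witness[of _ "\<lambda>k. m - k" "\<lambda>j. m - j"])
       (use binomial_symmetric[of "m + _" "2 * m"] in auto)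
  ultimately have "2 * (\<Sum>j\<le>m. ?b (m + j)) = (\<Sum>k\<in>{m..2 * m}. ?b k) + (\<Sum>k\<le>m. ?b k)"
    by simp
  also have "(\<Sum>k\<in>{m..2 * m}. ?b k) = ?b m + (\<Sum>k\<in>{Suc m..2 * m}. ?b k)"
    by (simp add: sum.atLeast_Suc_atMost)
  also have "\<dots> + (\<Sum>k\<le>m. ?b k) = (\<Sum>k\<in>{Suc m..2 * m} \<union> {..m}. ?b k) + ?b m"
    by (subst sum.union_disjoint) auto
  also have "{Suc m..2 * m} \<union> {..m} = {..2 * m}" by auto
  also have "(\<Sum>k\<le>2 * m. ?b k) = 2 ^ (2 * m)" by (rule choose_row_sum)
  finally show ?thesis .
qed

lemma partition_T_even:
  "partition_T (2 * m) 2 = (4 ^ m + real ((2 * m) choose m)) / 2"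
proof -
  \<comment> \<open>Only even heights are reachable in an even number of steps; height
    \<open>2 * j\<close> carries the coefficient with lower index \<open>m + j\<close>.\<close>
  have "partition_T (2 * m) 2 = (\<Sum>h\<in>(\<lambda>j. 2 * int j) ` {..m}. binomial_at_height (2 * m) h)"
    unfolding partition_T_sum
  proof (rule sum.mono_neutral_right)
    show "\<forall>h\<in>{0..int (2 * m)} - (\<lambda>j. 2 * int j) ` {..m}. binomial_at_height (2 * m) h = 0"
    proof
      fix h assume h: "h \<in> {0..int (2 * m)} - (\<lambda>j. 2 * int j) ` {..m}"
      have "odd h"
      proof
        assume "even h"
        then obtain k where "h = 2 * k" by (elim evenE)
        then have "h = 2 * int (nat k)" "nat k \<le> m" using h by auto
        then show False using h by blast
      qed
      then show "binomial_at_height (2 * m) h = 0" by (simp add: binomial_at_height_def)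
    qed
  qed auto
  also have "\<dots> = (\<Sum>j\<le>m. real ((2 * m) choose (m + j)))"
    by (subst sum.reindex) (auto simp: inj_on_def binomial_at_height_def nat_add_distrib intro!: sum.cong)
  also have "\<dots> = real (2 * (\<Sum>j\<le>m. (2 * m) choose (m + j))) / 2" by simp
  also have "\<dots> = (4 ^ m + real ((2 * m) choose m)) / 2"
    unfolding sum_upper_half_binomial by (simp add: power_mult)
  finally show ?thesis .
qed

subsection \<open>The normalised central binomial coefficient\<close>

text \<open>The probability that a simple symmetric walk on the integers is at its starting point
  after \<open>2 * k\<close> steps.\<close>

definition cbin :: "nat \<Rightarrow> real" where
  "cbin k = real ((2 * k) choose k) / 4 ^ k"

lemma avoid_ratio:
  assumes "k \<le> m"
  shows "partition_T_avoid (2 * m) 2 (2 * k) / partition_T (2 * m) 2 =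
    1 - cbin k * (1 + cbin (m - k)) / (1 + cbin m)"
proof -
  have pow: "(4::real) ^ m = 4 ^ k * 4 ^ (m - k)"
    using assms by (metis le_add_diff_inverse power_add)
  have T: "partition_T (2 * j) 2 = 4 ^ j * (1 + cbin j) / 2" for j
    unfolding partition_T_even cbin_def by (simp add: field_simps)
  have pos: "1 + cbin j > 0" for j
    by (simp add: cbin_def add_pos_nonneg)
  have D: "binomial_at_height (2 * k) 0 = 4 ^ k * cbin k"
    by (simp add: binomial_at_height_def cbin_def nat_mult_distrib)
  have "2 * m - 2 * k = 2 * (m - k)" by simp
  then have "partition_T_avoid (2 * m) 2 (2 * k) =
      4 ^ m * (1 + cbin m) / 2 - 4 ^ k * cbin k * (4 ^ (m - k) * (1 + cbin (m - k)) / 2)"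
    using assms by (subst partition_T_avoid_eq) (simp_all add: T D)
  also have "\<dots> = 4 ^ m * (1 + cbin m) / 2 - 4 ^ m * (cbin k * (1 + cbin (m - k))) / 2"
    by (simp add: pow)
  also have "\<dots> = 4 ^ m * (1 + cbin m) / 2 * (1 - cbin k * (1 + cbin (m - k)) / (1 + cbin m))"
  proof -
    have "x * y / 2 - x * r / 2 = x * y / 2 * (1 - r / y)" if "y > 0" for x y r :: real
      using that by (simp add: field_simps)
    from this[OF pos] show ?thesis .
  qed
  finally show ?thesis
    using pos[of m] by (simp add: T)
qed

lemma partition_T_even_pos: "partition_T (2 * m) 2 > 0"
  by (simp add: partition_T_even add_pos_nonneg)

lemma cbin_Suc: "cbin (Suc k) = cbin k * (2 * real k + 1) / (2 * real k + 2)"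
proof -
  \<comment> \<open>The absorption identity is used twice, in row \<open>2 * k + 2\<close> and,
    after a reflection, in row \<open>2 * k + 1\<close>.\<close>
  have "Suc k * (2 * Suc k choose Suc k) = 2 * ((2 * k + 1) * (2 * k choose k))"
  proof -
    have "Suc k * (Suc (Suc (2 * k)) choose Suc k) = Suc (Suc (2 * k)) * (Suc (2 * k) choose k)"
      by (rule Suc_times_binomial)
    moreover have "Suc k * (Suc (2 * k) choose k) = Suc (2 * k) * (2 * k choose k)"
    proof -
      have "Suc (2 * k) choose k = Suc (2 * k) choose Suc k"
        by (subst binomial_symmetric) (auto simp: Suc_diff_le)
      then show ?thesis by (simp only: Suc_times_binomial)
    qed
    ultimately show ?thesis by (simp add: algebra_simps)
  qed
  then have "real (Suc k) * real (2 * Suc k choose Suc k) = 2 * ((2 * real k + 1) * real (2 * k choose k))"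
    by (metis (no_types, lifting) of_nat_1 of_nat_add of_nat_mult of_nat_numeral)
  moreover have "B' / (4 * 4 ^ k) = B / 4 ^ k * (2 * x + 1) / (2 * x + 2)"
    if "(x + 1) * B' = 2 * ((2 * x + 1) * B)" "x \<ge> 0" for x B B' :: real
  proof -
    have "B' = 2 * ((2 * x + 1) * B) / (x + 1)" using that by (simp add: field_simps)
    then show ?thesis using that(2) by (simp add: divide_simps) (simp add: algebra_simps)
  qed
  ultimately show ?thesis by (simp only: cbin_def power_Suc of_nat_Suc add.commute[of 1])
qed

section \<open>Two-sided bounds from Wallis' product\<close>

lemma cbin_pos: "cbin k > 0"
  by (simp add: cbin_def)

text \<open>The sequence is exactly the reciprocal of the partial Wallis products, as both change by
  the same factor at each step.\<close>

lemma wallis_cbin: "(\<lambda>n. (2 * real n + 1) * cbin n ^ 2) \<longlonglongrightarrow> 2 / pi"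
proof -
  have "(2 * real n + 1) * cbin n ^ 2 = inverse (\<Prod>k=1..n. (4*real k^2) / (4*real k^2 - 1))" for n
  proof (induction n)
    case 0
    then show ?case by (simp add: cbin_def)
  next
    case (Suc n)
    have "(\<Prod>k=1..Suc n. (4*real k^2) / (4*real k^2 - 1)) =
        (\<Prod>k=1..n. (4*real k^2) / (4*real k^2 - 1)) * ((2*real n+2)^2 / ((2*real n+1)*(2*real n+3)))"
      by (simp add: power2_eq_square algebra_simps)
    \<comment> \<open>Used with \<open>z\<close>, \<open>y\<close>, \<open>w\<close> equal to
      \<open>2n + 1\<close>, \<open>2n + 2\<close>, \<open>2n + 3\<close>, with \<open>c\<close> the
      old \<open>cbin\<close> and \<open>p\<close> the old product.\<close>
    moreover have "w * (c * z / y) ^ 2 = inverse (p * (y ^ 2 / (z * w)))"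
      if "z * c ^ 2 = inverse p" "y > 0" "z > 0" for w c z y p :: real
    proof -
      have "w * (c * z / y) ^ 2 = z * c ^ 2 * (z * w / y ^ 2)"
        by (simp add: power2_eq_square)
      then show ?thesis using that by (simp add: divide_inverse mult_ac)
    qed
    ultimately show ?case
      using Suc by (simp add: cbin_Suc add.commute)
  qed
  moreover have "(\<lambda>n. inverse (\<Prod>k=1..n. (4*real k^2) / (4*real k^2 - 1))) \<longlonglongrightarrow> inverse (pi / 2)"
    by (intro tendsto_inverse wallis) auto
  ultimately show ?thesis by simp
qed

text \<open>The Wallis sequence decreases, because
  \<open>(2n + 1) (2n + 3) \<le> (2n + 2)^2\<close>, and hence stays above its limit.\<close>

lemma cbin_lower: "1 / sqrt (pi * (real k + 1 / 2)) \<le> cbin k"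
proof -
  have "decseq (\<lambda>n. (2 * real n + 1) * cbin n ^ 2)"
  proof (rule decseq_SucI)
    fix n
    have "(2 * real n + 3) * (2 * real n + 1) ^ 2 \<le> (2 * real n + 1) * (2 * real n + 2) ^ 2"
      by (simp add: power2_eq_square algebra_simps)
    then have "cbin n ^ 2 * ((2 * real n + 3) * (2 * real n + 1) ^ 2) / (2 * real n + 2) ^ 2
        \<le> cbin n ^ 2 * ((2 * real n + 1) * (2 * real n + 2) ^ 2) / (2 * real n + 2) ^ 2"
      by (intro divide_right_mono mult_left_mono) auto
    also have "cbin n ^ 2 * ((2 * real n + 3) * (2 * real n + 1) ^ 2) / (2 * real n + 2) ^ 2
        = (2 * real (Suc n) + 1) * cbin (Suc n) ^ 2"
      by (simp add: cbin_Suc power_divide power_mult_distrib mult_ac add_ac)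
    also have "cbin n ^ 2 * ((2 * real n + 1) * (2 * real n + 2) ^ 2) / (2 * real n + 2) ^ 2
        = (2 * real n + 1) * cbin n ^ 2"
      by (simp add: add_nonneg_eq_0_iff)
    finally show "(2 * real (Suc n) + 1) * cbin (Suc n) ^ 2 \<le> (2 * real n + 1) * cbin n ^ 2" .
  qed
  then have "2 / pi \<le> (2 * real k + 1) * cbin k ^ 2"
    using wallis_cbin by (rule decseq_ge)
  then have "1 \<le> cbin k ^ 2 * (pi * (real k + 1 / 2))"
    by (simp add: field_simps)
  then have "1 / (pi * (real k + 1 / 2)) \<le> cbin k ^ 2"
    by (subst pos_divide_le_eq) auto
  then have "sqrt (1 / (pi * (real k + 1 / 2))) \<le> sqrt (cbin k ^ 2)"
    by (rule real_sqrt_le_mono)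
  then show ?thesis
    using cbin_pos[of k] by (simp add: real_sqrt_divide)
qed

text \<open>With the factor \<open>2k\<close> in place of \<open>2k + 1\<close> the sequence
  increases to the same limit, because \<open>2n (2n + 2) \<le> (2n + 1)^2\<close>.\<close>

lemma cbin_upper:
  assumes "k > 0"
  shows "cbin k \<le> 1 / sqrt (pi * real k)"
proof -
  have "incseq (\<lambda>n. 2 * real n * cbin n ^ 2)"
  proof (rule incseq_SucI)
    fix n
    have "(2 * real n) * (2 * real n + 2) \<le> (2 * real n + 1) ^ 2"
      by (simp add: power2_eq_square algebra_simps)
    then have "(2 * real n) * cbin n ^ 2 \<le> (2 * real n + 1) ^ 2 / (2 * real n + 2) * cbin n ^ 2"
      by (intro mult_right_mono) (simp_all add: field_simps)
    also have "\<dots> = 2 * real (Suc n) * cbin (Suc n) ^ 2"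
      by (simp add: cbin_Suc power2_eq_square divide_simps)
    finally show "2 * real n * cbin n ^ 2 \<le> 2 * real (Suc n) * cbin (Suc n) ^ 2" .
  qed
  moreover have "(\<lambda>n. 2 * real n * cbin n ^ 2) \<longlonglongrightarrow> 2 / pi"
  proof -
    have "(\<lambda>n. (2 * real n / (2 * real n + 1)) * ((2 * real n + 1) * cbin n ^ 2)) \<longlonglongrightarrow> 1 * (2 / pi)"
      by (intro tendsto_mult wallis_cbin) real_asymp
    moreover have "2 * real n + 1 \<noteq> 0" for n by linarith
    ultimately show ?thesis by (simp add: mult.assoc)
  qed
  ultimately have "2 * real k * cbin k ^ 2 \<le> 2 / pi"
    by (rule incseq_le)
  then have "cbin k ^ 2 \<le> 1 / (pi * real k)"
    using assms by (simp add: field_simps)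
  then have "sqrt (cbin k ^ 2) \<le> sqrt (1 / (pi * real k))"
    by (rule real_sqrt_le_mono)
  then show ?thesis
    using cbin_pos[of k] by (simp add: real_sqrt_divide)
qed

subsection \<open>Asymptotic expansion\<close>

lemma cbin_linear_bigo:
  fixes r :: "nat \<Rightarrow> nat" and c :: real
  assumes "c > 0" and r: "\<And>m. \<bar>real (r m) - c * real m\<bar> \<le> 1"
  shows "(\<lambda>m. cbin (r m) - 1 / sqrt (pi * c * real m)) \<in> O(\<lambda>m. real m powr (- 3 / 2))"
proof -
  let ?u = "\<lambda>m. 1 / sqrt (pi * c * real m)"
  \<comment> \<open>Rounding shifts the argument by at most 1 either way; the lower bound for
    \<open>cbin\<close> adds a further 1/2.\<close>
  let ?l = "\<lambda>m. 1 / sqrt (pi * (c * real m + 3 / 2))" and ?h = "\<lambda>m. 1 / sqrt (pi * (c * real m - 1))"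
  \<comment> \<open>This makes the radicand in \<open>?h\<close> positive and forces
    \<open>r m > 0\<close>, as \<open>cbin_upper\<close> requires.\<close>
  have big: "eventually (\<lambda>m. c * real m > 1) at_top"
    using \<open>c > 0\<close> by real_asymp
  have "(\<lambda>m. cbin (r m) - ?u m) \<in> O(\<lambda>m. \<bar>?l m - ?u m\<bar> + \<bar>?h m - ?u m\<bar>)"
  proof (rule bigoI[of _ 1], use big in eventually_elim)
    case (elim m)
    have rm: "c * real m - 1 \<le> real (r m)" "real (r m) \<le> c * real m + 1"
      using r[of m] by linarith+
    have "?l m \<le> 1 / sqrt (pi * (real (r m) + 1 / 2))"
      using rm elim by (intro divide_left_mono real_sqrt_le_mono mult_left_mono) (auto intro!: mult_pos_pos add_pos_pos)
    also have "\<dots> \<le> cbin (r m)" by (rule cbin_lower)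
    finally have lo: "?l m \<le> cbin (r m)" .
    have "r m > 0" using rm elim by (cases "r m") auto
    then have "cbin (r m) \<le> 1 / sqrt (pi * real (r m))" by (rule cbin_upper)
    also have "\<dots> \<le> ?h m"
      using rm elim by (intro divide_left_mono real_sqrt_le_mono mult_left_mono) (auto intro!: mult_pos_pos)
    finally show ?case using lo by simp
  qed
  also have "(\<lambda>m. \<bar>?l m - ?u m\<bar> + \<bar>?h m - ?u m\<bar>) \<in> O(\<lambda>m. real m powr (- 3 / 2))"
  proof (rule sum_in_bigo)
    show "(\<lambda>m. \<bar>?l m - ?u m\<bar>) \<in> O(\<lambda>m. real m powr (- 3 / 2))"
      using \<open>c > 0\<close> by real_asymp
    show "(\<lambda>m. \<bar>?h m - ?u m\<bar>) \<in> O(\<lambda>m. real m powr (- 3 / 2))"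
      using \<open>c > 0\<close> by real_asymp
  qed
  finally show ?thesis .
qed

text \<open>Expand \<open>(1 + V) / (1 + M) = 1 + (V - M) - (V - M) M / (1 + M)\<close>. Multiplied
  by \<open>U\<close>, the last term has three factors of order \<open>g\<close>, so it is
  \<open>O(e)\<close>; nonnegativity of \<open>M\<close> bounds the denominator away from 0.
  Replacing \<open>U\<close>, \<open>V\<close>, \<open>M\<close> by their approximations in the
  other terms costs \<open>O(e)\<close>.\<close>

lemma ratio_bigo:
  fixes U V M U0 V0 M0 :: "nat \<Rightarrow> real"
  defines "g \<equiv> \<lambda>m. real m powr (- 1 / 2)" and "e \<equiv> \<lambda>m. real m powr (- 3 / 2)"
  assumes U: "(\<lambda>m. U m - U0 m) \<in> O(e)" and V: "(\<lambda>m. V m - V0 m) \<in> O(e)" and M: "(\<lambda>m. M m - M0 m) \<in> O(e)"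
    and U0: "U0 \<in> O(g)" and V0: "V0 \<in> O(g)" and M0: "M0 \<in> O(g)"
    and pos: "\<And>m. M m \<ge> 0"
  shows "(\<lambda>m. U m * (1 + V m) / (1 + M m) - (U0 m + U0 m * (V0 m - M0 m))) \<in> O(e)"
proof -
  have eg: "e \<in> O(g)" unfolding e_def g_def by real_asymp
  have gO: "f \<in> O(g)" if "(\<lambda>m. f m - f0 m) \<in> O(e)" "f0 \<in> O(g)" for f f0 :: "nat \<Rightarrow> real"
    using sum_in_bigo(1)[OF landau_o.big_trans[OF that(1) eg] that(2)] by simp
  have ggg: "(\<lambda>m. g m * (g m * g m)) \<in> O(e)" unfolding e_def g_def by real_asymp
  have ge: "(\<lambda>m. g m * e m) \<in> O(e)" unfolding e_def g_def by real_asymp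
  have 1: "(\<lambda>m. 1 / (1 + M m)) \<in> O(\<lambda>_. 1)"
  proof (rule bigoI[of _ 1], rule always_eventually, rule allI)
    show "norm (1 / (1 + M m)) \<le> 1 * norm (1 :: real)" for m
      using pos[of m] by simp
  qed
  have UVM: "(\<lambda>m. V m - M m) \<in> O(g)"
    by (intro sum_in_bigo gO[OF V V0] gO[OF M M0])
  have "(\<lambda>m. U m * ((V m - M m) * M m) * (1 / (1 + M m))) \<in> O(\<lambda>m. g m * (g m * g m) * 1)"
    by (intro landau_o.big.mult UVM gO[OF U U0] gO[OF M M0] 1)
  then have a: "(\<lambda>m. U m * ((V m - M m) * M m) * (1 / (1 + M m))) \<in> O(e)"
    using ggg by (simp add: landau_o.big_trans)
  have b: "(\<lambda>m. (V m - M m) * (U m - U0 m)) \<in> O(e)"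
    using landau_o.big.mult[OF UVM U] ge by (rule landau_o.big_trans)
  have c: "(\<lambda>m. U0 m * ((V m - V0 m) - (M m - M0 m))) \<in> O(e)"
    using landau_o.big.mult[OF U0 sum_in_bigo(2)[OF V M]] ge by (rule landau_o.big_trans)
  have "U m * (1 + V m) / (1 + M m) - (U0 m + U0 m * (V0 m - M0 m)) =
     (U m - U0 m) + (V m - M m) * (U m - U0 m) + U0 m * ((V m - V0 m) - (M m - M0 m))
       - U m * ((V m - M m) * M m) * (1 / (1 + M m))" for m
  proof -
    have "1 + M m \<noteq> 0" using pos[of m] by linarith
    then show ?thesis by (simp add: divide_simps) (simp add: algebra_simps)
  qed
  then show ?thesis
    using sum_in_bigo(2)[OF sum_in_bigo(1)[OF sum_in_bigo(1)[OF U b] c] a] by (simp only:)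
qed

lemma cbin_ratio_bigo:
  fixes a :: real
  assumes "0 < a" "a < 1"
  defines "k \<equiv> \<lambda>m. nat \<lfloor>a * real m\<rfloor>"
  shows "(\<lambda>m. cbin (k m) * (1 + cbin (m - k m)) / (1 + cbin m) -
      (2 / sqrt (2 * pi * real (2 * m) * a)
       - 2 * (1 - a - sqrt (1 - a)) / (pi * real (2 * m) * sqrt a * (1 - a))))
     \<in> O(\<lambda>m. real m powr (- 3 / 2))"
proof -
  have k: "real (k m) \<le> a * real m" "a * real m < real (k m) + 1" for m
    using assms(1) unfolding k_def by (auto simp: of_nat_nat)
  have km: "k m \<le> m" for m
  proof -
    have "a * real m \<le> 1 * real m" using assms by (intro mult_right_mono) auto
    then show ?thesis using k(1)[of m] by linarith
  qed
  let ?u = "\<lambda>c m. 1 / sqrt (pi * c * real m)"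
  have O: "?u c \<in> O(\<lambda>m. real m powr (- 1 / 2))" if "c > 0" for c
    using that by real_asymp
  have r1: "\<bar>real (k m) - a * real m\<bar> \<le> 1" for m
    using k[of m] by linarith
  have r2: "\<bar>real (m - k m) - (1 - a) * real m\<bar> \<le> 1" for m
    using k[of m] km[of m] by (simp add: of_nat_diff algebra_simps)
  have "(\<lambda>m. cbin (k m) * (1 + cbin (m - k m)) / (1 + cbin m) -
      (?u a m + ?u a m * (?u (1 - a) m - ?u 1 m))) \<in> O(\<lambda>m. real m powr (- 3 / 2))"
    using assms(1,2) cbin_pos
    by (intro ratio_bigo O cbin_linear_bigo r1 r2) (auto intro: less_imp_le)
  moreover have "?u a m + ?u a m * (?u (1 - a) m - ?u 1 m) = 2 / sqrt (2 * pi * real (2 * m) * a)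
       - 2 * (1 - a - sqrt (1 - a)) / (pi * real (2 * m) * sqrt a * (1 - a))" for m
  proof -
    \<comment> \<open>In terms of \<open>s\<close>, \<open>t\<close> and \<open>sqrt a\<close> the
      claim becomes a rational identity; the second-order term is
      \<open>(1 - s) / (sqrt a * s * t^2)\<close>.\<close>
    define s t where "s = sqrt (1 - a)" and "t = sqrt (pi * real m)"
    have s: "s > 0" "1 - a = s ^ 2" using assms by (auto simp: s_def)
    have t: "pi * real m = t ^ 2" by (simp add: t_def)
    have e1: "sqrt (pi * c * real m) = sqrt c * t" for c
      by (simp add: t_def real_sqrt_mult)
    have e2: "sqrt (2 * pi * real (2 * m) * a) = 2 * (sqrt a * t)"
    proof -
      have "2 * pi * real (2 * m) * a = 2 ^ 2 * (a * (pi * real m))" by simp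
      then show ?thesis by (simp add: real_sqrt_mult t_def)
    qed
    have e3: "pi * real (2 * m) * sqrt a * (1 - a) = 2 * t ^ 2 * sqrt a * s ^ 2"
      using t s(2) by simp
    have e4: "1 - a - sqrt (1 - a) = s ^ 2 - s" using s(2) unfolding s_def[symmetric] by simp
    show ?thesis
      unfolding e3 e4 unfolding e1 e2 s_def[symmetric]
      \<comment> \<open>\<open>t = 0\<close> means \<open>m = 0\<close>, where both sides are 0 by
        the convention for division by zero.\<close>
      using s(1) assms(1) by (cases "t = 0") (simp_all add: field_simps power2_eq_square)
  qed
  ultimately show ?thesis by simp
qed

subsection \<open>The pressure\<close>

lemma cbin_decseq: "decseq cbin"
proof (rule decseq_SucI)
  show "cbin (Suc k) \<le> cbin k" for k
    using cbin_pos[of k] by (simp add: cbin_Suc divide_le_eq)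
qed

text \<open>For positive \<open>k\<close> the numerator is at most \<open>1/2 * 2 = 1\<close>, while
  the denominator exceeds 1. This makes the avoiding partition function positive, so the two
  logarithms in \<open>pressure\<close> can be merged.\<close>

lemma cbin_ratio_less_1:
  assumes "k > 0"
  shows "cbin k * (1 + cbin j) / (1 + cbin m) < 1"
proof -
  have "cbin k \<le> cbin 1" "cbin j \<le> cbin 0"
    using assms by (auto intro!: decseqD[OF cbin_decseq])
  then have "cbin k \<le> 1 / 2" "1 + cbin j \<le> 2"
    by (auto simp: cbin_def)
  then have "cbin k * (1 + cbin j) \<le> 1 / 2 * 2"
    using cbin_pos[of j] by (intro mult_mono) auto
  then show ?thesis
    using cbin_pos[of m] by simp
qed

lemma pressure_even:
  assumes "0 < k" "k \<le> m"
  shows "pressure (2 * m) 2 (2 * k) = ln (1 - cbin k * (1 + cbin (m - k)) / (1 + cbin m))"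
proof -
  have "partition_T_avoid (2 * m) 2 (2 * k) / partition_T (2 * m) 2 > 0"
    unfolding avoid_ratio[OF assms(2)] using cbin_ratio_less_1[OF assms(1)] by simp
  then have "partition_T_avoid (2 * m) 2 (2 * k) > 0"
    using partition_T_even_pos[of m] by (simp add: zero_less_divide_iff)
  then show ?thesis
    using partition_T_even_pos[of m]
    unfolding pressure_def avoid_ratio[OF assms(2), symmetric] by (simp add: ln_divide_pos)
qed

lemma eventually_even_at_top:
  "eventually P even_at_top \<longleftrightarrow> eventually (\<lambda>n. even n \<longrightarrow> P n) at_top"
  by (simp add: even_at_top_def eventually_inf_principal)

text \<open>Transfers estimates from the half-length to the length: for even \<open>n\<close> the
  integer division is exact, so the power only picks up a constant factor.\<close>

lemma half_bigo_even_at_top: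
  assumes "f \<in> O(\<lambda>m. real m powr c)"
  shows "(\<lambda>n. f (n div 2)) \<in> O[even_at_top](\<lambda>n. real n powr c)"
proof -
  have "filterlim (\<lambda>n::nat. n div 2) at_top at_top"
    unfolding filterlim_at_top
  proof
    show "\<forall>\<^sub>F n in at_top. Z \<le> n div 2" for Z :: nat
      by (rule eventually_at_top_linorderI[of "2 * Z"]) linarith
  qed
  then have "filterlim (\<lambda>n::nat. n div 2) at_top even_at_top"
    by (rule filterlim_mono) (auto simp: even_at_top_def)
  with assms have "(\<lambda>n. f (n div 2)) \<in> O[even_at_top](\<lambda>n. real (n div 2) powr c)"
    by (rule landau_o.big.compose)
  also have "(\<lambda>n. real (n div 2) powr c) \<in> O[even_at_top](\<lambda>n. real n powr c)"
  proof (rule bigoI[of _ "(1 / 2) powr c"])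
    have "real (n div 2) powr c = (1 / 2) powr c * real n powr c" if "even n" for n
      using that by (auto elim!: evenE simp flip: powr_mult)
    then show "\<forall>\<^sub>F n in even_at_top.
        norm (real (n div 2) powr c) \<le> (1 / 2) powr c * norm (real n powr c)"
      by (simp add: eventually_even_at_top)
  qed
  finally show ?thesis .
qed

theorem mainTheorem4:
  fixes a :: real
  assumes "0 < a" and "a < 1"
  shows "\<exists>E :: nat \<Rightarrow> real.
    E \<in> O[even_at_top](\<lambda>n. real n powr (- 3 / 2)) \<and>
    (\<forall>\<^sub>F n in even_at_top.
       pressure n 2 (2 * nat \<lfloor>a * real n / 2\<rfloor>) =
       ln (1 - 2 / sqrt (2 * pi * real n * a)
             + 2 * (1 - a - sqrt (1 - a)) / (pi * real n * sqrt a * (1 - a))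
             + E n))"
proof -
  define R where "R = (\<lambda>m. cbin (nat \<lfloor>a * real m\<rfloor>) * (1 + cbin (m - nat \<lfloor>a * real m\<rfloor>)) / (1 + cbin m))"
  define M where "M = (\<lambda>n. 2 / sqrt (2 * pi * real n * a)
       - 2 * (1 - a - sqrt (1 - a)) / (pi * real n * sqrt a * (1 - a)))"
  \<comment> \<open>Writing \<open>2 * (n div 2)\<close> for \<open>n\<close> makes \<open>E\<close>
    a function of \<open>n div 2\<close> alone, as \<open>half_bigo_even_at_top\<close> expects; for
    even \<open>n\<close> nothing changes.\<close>
  define E where "E = (\<lambda>n. - (R (n div 2) - M (2 * (n div 2))))"
  have "(\<lambda>m. R m - M (2 * m)) \<in> O(\<lambda>m. real m powr (- 3 / 2))"
    unfolding R_def M_def by (rule cbin_ratio_bigo[OF assms])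
  from half_bigo_even_at_top[OF this] have "E \<in> O[even_at_top](\<lambda>n. real n powr (- 3 / 2))"
    unfolding E_def by (simp only: landau_o.big.uminus_in_iff)
  moreover have "\<forall>\<^sub>F n in even_at_top. pressure n 2 (2 * nat \<lfloor>a * real n / 2\<rfloor>) =
       ln (1 - 2 / sqrt (2 * pi * real n * a)
             + 2 * (1 - a - sqrt (1 - a)) / (pi * real n * sqrt a * (1 - a)) + E n)"
    unfolding eventually_even_at_top
  proof -
    \<comment> \<open>For \<open>n = 2 * m\<close> this gives \<open>a * real m \<ge> 1\<close>, so
      the chosen vertex is not the origin, where \<open>pressure\<close> would be a junk
      value.\<close>
    have "\<forall>\<^sub>F n in at_top. a * real n \<ge> 2"
      using assms(1) by real_asymp
    then show "\<forall>\<^sub>F n in at_top. even n \<longrightarrow> pressure n 2 (2 * nat \<lfloor>a * real n / 2\<rfloor>) =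
       ln (1 - 2 / sqrt (2 * pi * real n * a)
             + 2 * (1 - a - sqrt (1 - a)) / (pi * real n * sqrt a * (1 - a)) + E n)"
    proof eventually_elim
      case (elim n)
      show ?case
      proof
        assume "even n"
        then obtain m where n: "n = 2 * m" by (elim evenE)
        define k where "k = nat \<lfloor>a * real m\<rfloor>"
        have "a * real m \<ge> 1" using elim n by simp
        then have "k > 0" by (simp add: k_def)
        moreover have "k \<le> m"
        proof -
          have "a * real m \<le> 1 * real m" using assms by (intro mult_right_mono) auto
          then show ?thesis unfolding k_def by linarith
        qed
        ultimately have "pressure n 2 (2 * k) = ln (1 - R m)"
          unfolding n R_def k_def[symmetric] by (rule pressure_even)
        moreover have "1 - R m = 1 - 2 / sqrt (2 * pi * real n * a)
             + 2 * (1 - a - sqrt (1 - a)) / (pi * real n * sqrt a * (1 - a)) + E n"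
          by (simp add: E_def M_def n)
        moreover have "nat \<lfloor>a * real n / 2\<rfloor> = k" by (simp add: k_def n)
        ultimately show "pressure n 2 (2 * nat \<lfloor>a * real n / 2\<rfloor>) =
          ln (1 - 2 / sqrt (2 * pi * real n * a)
             + 2 * (1 - a - sqrt (1 - a)) / (pi * real n * sqrt a * (1 - a)) + E n)"
          by simp
      qed
    qed
  qed
  ultimately show ?thesis by blast
qed

end
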